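(* There exists $Z_{XY} \in \mathfrak{X}^{S^1}_0$ (that is, with $X$ a constant vector field inside $S^1$ and $Y$ an affine vector field with a singularity of center type outside $S^1$) that has exactly one crossing limit cycle that intersects $S^1$ in two points.
   Context: Let $S^1=\{(x,y)\in\mathbb R^2: x^2+y^2=1\}$ and $h(x,y)=x^2+y^2-1$. For smooth vector fields $X,Y$ on $\mathbb R^2$, $Z_{XY}$ denotes the piecewise smooth vector field equal to $X$ where $h\le 0$ and to $Y$ where $h\ge 0$, with Filippov's convention on $S^1$. Write $Xh=\langle X,\nabla h\rangle$ and $Yh=\langle Y,\nabla h\rangle$. The crossing region is $\{z\in S^1: Xh(z)\,Yh(z)>0\}$; there, trajectories of $X$ and $Y$ are concatenated. A crossing periodic orbit is a closed nonconstant trajectory of $Z_{XY}$, obtained by concatenating arcs of $X$-trajectories in $h\le 0$ and arcs of $Y$-trajectories in $h\ge 0$, that meets $S^1$ only at points of the crossing region. A crossing limit cycle is a crossing periodic orbit having a neighbourhood that contains no other periodic orbit. "Intersects $S^1$ in two points" means in exactly two distinct points. "Linear vector field" means an affine vector field $z\mapsto Az+b$. Its singularity is of center type if $A$ has nonzero purely imaginary eigenvalues. $\mathfrak{X}^{S^1}_0$ is the set of $Z_{XY}$ with $X$ constant and $Y$ linear with a singularity of center type. *)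

theory Defs
  imports "HOL-Analysis.Analysis"
begin

type_synonym vfield = "real^2 \<Rightarrow> real^2"

definition h :: "real^2 \<Rightarrow> real" where
  "h z = (z $ 1)\<^sup>2 + (z $ 2)\<^sup>2 - 1"

definition S1 :: "(real^2) set" where
  "S1 = {z. (z $ 1)\<^sup>2 + (z $ 2)\<^sup>2 = 1}"

definition grad_h :: "real^2 \<Rightarrow> real^2" where
  "grad_h z = 2 *\<^sub>R z"

lemma GDERIV_h: "GDERIV h z :> grad_h z"
proof -
  have "h = (\<lambda>z. z \<bullet> z - 1)"
    by (auto simp: fun_eq_iff h_def inner_vec_def sum_2 power2_eq_square)
  moreover have "((\<lambda>z::real^2. z \<bullet> z - 1) has_derivative (\<lambda>v. v \<bullet> (2 *\<^sub>R z))) (at z)"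
    by (auto intro!: derivative_eq_intros simp: inner_commute)
  ultimately show ?thesis
    by (simp add: gderiv_def grad_h_def)
qed

text \<open>The piecewise smooth field \<open>Z\<^sub>X\<^sub>Y\<close> is represented by the pair \<open>(X, Y)\<close>:
  \<open>X\<close> acts where \<open>h \<le> 0\<close> and \<open>Y\<close> where \<open>h \<ge> 0\<close>.\<close>

type_synonym pwfield = "vfield \<times> vfield"

definition lie_h :: "vfield \<Rightarrow> real^2 \<Rightarrow> real" where
  "lie_h V z = V z \<bullet> grad_h z"

definition crossing_region :: "pwfield \<Rightarrow> (real^2) set" where
  "crossing_region Z = {z \<in> S1. lie_h (fst Z) z * lie_h (snd Z) z > 0}"

text \<open>Filippov's convention: trajectories are the absolutely continuous solutions of the
  differential inclusion given by the following set-valued field.\<close>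

definition filippov_field :: "pwfield \<Rightarrow> real^2 \<Rightarrow> (real^2) set" where
  "filippov_field Z z =
     (if h z < 0 then {fst Z z}
      else if h z > 0 then {snd Z z}
      else convex hull {fst Z z, snd Z z})"

text \<open>Absolute continuity is expressed by writing the curve as the integral of an
  absolutely integrable function, which is then its derivative almost everywhere.\<close>

definition filippov_trajectory :: "pwfield \<Rightarrow> (real \<Rightarrow> real^2) \<Rightarrow> real \<Rightarrow> real \<Rightarrow> bool" where
  "filippov_trajectory Z \<phi> a b \<longleftrightarrow>
     (\<exists>g N. g absolutely_integrable_on {a..b} \<and> negligible N \<and>
        (\<forall>t\<in>{a..b}. \<phi> t = \<phi> a + integral {a..t} g) \<and>
        (\<forall>t\<in>{a..b} - N. g t \<in> filippov_field Z (\<phi> t)))"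

definition periodic_orbit :: "pwfield \<Rightarrow> (real^2) set \<Rightarrow> bool" where
  "periodic_orbit Z \<gamma> \<longleftrightarrow>
     (\<exists>\<phi> T. T > 0 \<and> filippov_trajectory Z \<phi> 0 T \<and> \<phi> 0 = \<phi> T \<and>
        (\<exists>t\<in>{0..T}. \<phi> t \<noteq> \<phi> 0) \<and> \<gamma> = \<phi> ` {0..T})"

definition arc_of :: "vfield \<Rightarrow> (real \<Rightarrow> real^2) \<Rightarrow> real \<Rightarrow> real \<Rightarrow> bool" where
  "arc_of V \<phi> a b \<longleftrightarrow>
     (\<forall>t\<in>{a..b}. (\<phi> has_vector_derivative V (\<phi> t)) (at t within {a..b}))"

definition crossing_periodic_orbit :: "pwfield \<Rightarrow> (real^2) set \<Rightarrow> bool" where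
  "crossing_periodic_orbit Z \<gamma> \<longleftrightarrow>
     (\<exists>\<phi> T (n::nat) s. T > 0 \<and> s 0 = 0 \<and> s n = T \<and>
        (\<forall>i<n. s i < s (Suc i) \<and>
           (arc_of (fst Z) \<phi> (s i) (s (Suc i)) \<and> (\<forall>t\<in>{s i..s (Suc i)}. h (\<phi> t) \<le> 0) \<or>
            arc_of (snd Z) \<phi> (s i) (s (Suc i)) \<and> (\<forall>t\<in>{s i..s (Suc i)}. h (\<phi> t) \<ge> 0))) \<and>
        \<phi> 0 = \<phi> T \<and> (\<exists>t\<in>{0..T}. \<phi> t \<noteq> \<phi> 0) \<and>
        \<gamma> = \<phi> ` {0..T} \<and> \<gamma> \<inter> S1 \<subseteq> crossing_region Z)"

definition crossing_limit_cycle :: "pwfield \<Rightarrow> (real^2) set \<Rightarrow> bool" where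
  "crossing_limit_cycle Z \<gamma> \<longleftrightarrow>
     crossing_periodic_orbit Z \<gamma> \<and>
     (\<exists>U. open U \<and> \<gamma> \<subseteq> U \<and> (\<forall>\<delta>. periodic_orbit Z \<delta> \<and> \<delta> \<subseteq> U \<longrightarrow> \<delta> = \<gamma>))"

definition complex_eigenvalue :: "real^'n^'n \<Rightarrow> complex \<Rightarrow> bool" where
  "complex_eigenvalue A \<mu> \<longleftrightarrow>
     (\<exists>w :: complex^'n. w \<noteq> 0 \<and> map_matrix complex_of_real A *v w = \<mu> *s w)"

text \<open>As \<open>A\<close> is a real 2x2 matrix, the other eigenvalue is the conjugate \<open>- \<i> \<omega>\<close>; in particular
  \<open>A\<close> is invertible and \<open>z \<mapsto> A z + b\<close> has exactly one singularity.\<close>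

definition center_type :: "real^2^2 \<Rightarrow> bool" where
  "center_type A \<longleftrightarrow> (\<exists>\<omega>::real. \<omega> \<noteq> 0 \<and> complex_eigenvalue A (\<i> * complex_of_real \<omega>))"

definition X_S1_0 :: "pwfield set" where
  "X_S1_0 = {(X, Y). (\<exists>c. X = (\<lambda>z. c)) \<and>
                     (\<exists>A b. center_type A \<and> Y = (\<lambda>z. A *v z + b))}"

end

theory Submission
  imports Defs
begin

text \<open>
  Take \<open>X = (1, 0)\<close> and \<open>Y(x, y) = (4/3 - x - 2y, x + y)\<close>. In the sheared coordinate
  \<open>\<zeta> = (x + y) + \<i> (y - 4/3)\<close> the outer flow is the rotation \<open>\<zeta>' = \<i> \<zeta>\<close> and the inner flow is
  \<open>\<zeta>' = 1\<close>; the cycle is the segment \<open>y = 0\<close> of the disc closed up by the arc \<open>\<bar>\<zeta>\<bar> = 5/3\<close>.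

  Two monotone quantities control every closed trajectory that meets the circle only in the
  crossing region. The function \<open>V = \<bar>\<zeta>\<bar>\<^sup>2 - 25/9 - min h 0\<close> is constant along \<open>Y\<close>; inside
  the disc it equals \<open>y (2x + y - 8/3)\<close>, whose square strictly decreases along \<open>X\<close> off \<open>y = 0\<close>.
  Hence a closed trajectory that enters the disc lies in \<open>V = 0\<close>, which is the cycle. The argument of \<open>\<zeta>\<close>
  increases along both fields, so a closed trajectory meets every ray from \<open>\<zeta> = 0\<close>: one
  inside the cycle fills it, and one staying outside the disc can be excluded from a
  neighbourhood of the cycle by removing a single ray.
\<close>

section \<open>Monotonicity with finitely many exceptional times\<close>

lemma nondecreasing_off_finite:
  fixes f D :: "real \<Rightarrow> real"
  assumes "finite S" "a \<le> b" "continuous_on {a..b} f"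
    and D: "\<And>t. t \<in> {a<..<b} - S \<Longrightarrow> (f has_real_derivative D t) (at t) \<and> D t \<ge> 0"
  shows "f a \<le> f b"
proof -
  \<comment> \<open>\<open>D\<close> is controlled only off \<open>S\<close> and the endpoints; the
    value 0 there makes the integrand nonnegative everywhere.\<close>
  define E where "E = (\<lambda>t. if t \<in> {a<..<b} - S then D t else 0)"
  have "(E has_integral (f b - f a)) {a..b}"
    using assms by (intro fundamental_theorem_of_calculus_interior_strong[of S])
      (auto simp: E_def has_real_derivative_iff_has_vector_derivative)
  then have "0 \<le> f b - f a"
    by (rule has_integral_nonneg) (use D in \<open>auto simp: E_def\<close>)
  then show ?thesis by simp
qed

text \<open>Monotonicity on both sides of \<open>t\<close> squeezes \<open>f t\<close> between the
  equal values \<open>f a\<close> and \<open>f b\<close>. Both monotone quantities act on closed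
  trajectories through this rigidity.\<close>

lemma closed_nondecreasing_const:
  fixes f D :: "real \<Rightarrow> real"
  assumes "finite S" "continuous_on {a..b} f" "f a = f b"
    and D: "\<And>t. t \<in> {a<..<b} - S \<Longrightarrow> (f has_real_derivative D t) (at t) \<and> D t \<ge> 0"
  shows "\<And>t. t \<in> {a..b} \<Longrightarrow> f t = f a"
    and "\<And>t. t \<in> {a<..<b} - S \<Longrightarrow> D t = 0"
proof -
  show const: "f t = f a" if "t \<in> {a..b}" for t
  proof -
    have "f a \<le> f t"
      by (rule nondecreasing_off_finite[OF \<open>finite S\<close> _ continuous_on_subset[OF assms(2)] D])
        (use that in auto)
    moreover have "f t \<le> f b"
      by (rule nondecreasing_off_finite[OF \<open>finite S\<close> _ continuous_on_subset[OF assms(2)] D])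
        (use that in auto)
    ultimately show ?thesis using assms(3) by simp
  qed
  show "D t = 0" if t: "t \<in> {a<..<b} - S" for t
  proof (rule DERIV_unique)
    show "(f has_real_derivative D t) (at t)" using D[OF t] by simp
    show "(f has_real_derivative 0) (at t)"
    proof (rule has_field_derivative_transform_within_open[OF DERIV_const[of "f a"]])
      show "f a = f s" if "s \<in> {a<..<b}" for s using const[of s] that by simp
    qed (use t in auto)
  qed
qed

section \<open>Filippov trajectories that meet the circle only in the crossing region\<close>

lemma filippov_field_inner_ge:
  assumes "v \<in> filippov_field Z z" "m \<le> fst Z z \<bullet> w" "m \<le> snd Z z \<bullet> w"
  shows "m \<le> v \<bullet> w"
proof -
  have "v \<in> convex hull {fst Z z, snd Z z}"
    using assms(1) by (auto simp: filippov_field_def hull_inc split: if_split_asm)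
  then obtain p q where v: "v = p *\<^sub>R fst Z z + q *\<^sub>R snd Z z" "0 \<le> p" "0 \<le> q" "p + q = 1"
    by (auto simp: convex_hull_2)
  have "m = p * m + q * m" using v(4) by (simp add: distrib_right[symmetric])
  also have "\<dots> \<le> p * (fst Z z \<bullet> w) + q * (snd Z z \<bullet> w)"
    using v assms by (intro add_mono mult_left_mono) auto
  finally show ?thesis by (simp add: v inner_add_left)
qed

lemma h_inner: "h z = z \<bullet> z - 1"
  by (simp add: h_def inner_vec_def sum_2 power2_eq_square)

lemma continuous_on_h [continuous_intros]:
  "continuous_on A f \<Longrightarrow> continuous_on A (\<lambda>x. h (f x))"
  unfolding h_def by (intro continuous_intros)

lemma S1_iff: "z \<in> S1 \<longleftrightarrow> h z = 0"
  by (simp add: S1_def h_def)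

text \<open>The common setting for crossing periodic orbits and for arbitrary Filippov periodic
  orbits near the cycle: \<open>cross\<close> constrains only the points visited.\<close>

locale crossing_trajectory =
  fixes Z :: pwfield and \<phi> :: "real \<Rightarrow> real^2" and T :: real
  assumes cont_fst: "continuous_on UNIV (fst Z)" and cont_snd: "continuous_on UNIV (snd Z)"
    and T_pos: "T > 0"
    and traj: "filippov_trajectory Z \<phi> 0 T"
    and cross: "\<And>t. t \<in> {0..T} \<Longrightarrow> \<phi> t \<in> S1 \<Longrightarrow> \<phi> t \<in> crossing_region Z"
begin

lemma obtain_velocity:
  obtains g N where "negligible N"
    "\<And>u v. 0 \<le> u \<Longrightarrow> u \<le> v \<Longrightarrow> v \<le> T \<Longrightarrow> (g has_integral (\<phi> v - \<phi> u)) {u..v}"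
    "\<And>t. t \<in> {0..T} - N \<Longrightarrow> g t \<in> filippov_field Z (\<phi> t)"
proof -
  obtain g N where g: "g absolutely_integrable_on {0..T}" "negligible N"
    "\<And>t. t \<in> {0..T} \<Longrightarrow> \<phi> t = \<phi> 0 + integral {0..t} g"
    "\<And>t. t \<in> {0..T} - N \<Longrightarrow> g t \<in> filippov_field Z (\<phi> t)"
    using traj unfolding filippov_trajectory_def by blast
  have int: "g integrable_on {0..T}"
    using g(1) by (simp add: absolutely_integrable_on_def)
  have "(g has_integral (\<phi> v - \<phi> u)) {u..v}" if "0 \<le> u" "u \<le> v" "v \<le> T" for u v
  proof -
    have i: "g integrable_on {0..v}" "g integrable_on {u..v}"
      by (rule integrable_on_subinterval[OF int]; use that in auto)+
    have "integral {0..u} g + integral {u..v} g = integral {0..v} g"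
      using that i by (intro Henstock_Kurzweil_Integration.integral_combine) auto
    moreover have "\<phi> u = \<phi> 0 + integral {0..u} g" "\<phi> v = \<phi> 0 + integral {0..v} g"
      by (rule g(3); use that in simp)+
    ultimately have "integral {u..v} g = \<phi> v - \<phi> u"
      by (metis add_diff_cancel_left add_diff_cancel_left')
    then show ?thesis using i(2) by (simp add: has_integral_integrable_integral)
  qed
  then show thesis by (rule that[OF g(2) _ g(4)])
qed

lemma cont: "continuous_on {0..T} \<phi>"
proof -
  obtain g N where g: "g absolutely_integrable_on {0..T}"
    "\<And>t. t \<in> {0..T} \<Longrightarrow> \<phi> t = \<phi> 0 + integral {0..t} g"
    using traj unfolding filippov_trajectory_def by blast
  have "g integrable_on {0..T}"
    using g(1) by (simp add: absolutely_integrable_on_def)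
  then have "continuous_on {0..T} (\<lambda>t. \<phi> 0 + integral {0..t} g)"
    by (intro continuous_intros indefinite_integral_continuous_1)
  then show ?thesis by (rule continuous_on_eq) (rule g(2)[symmetric])
qed

lemma h_neighbourhood:
  assumes "t \<in> {0<..<T}" "open A" "h (\<phi> t) \<in> A"
  shows "\<exists>u v. 0 \<le> u \<and> u < t \<and> t < v \<and> v \<le> T \<and> (\<forall>r\<in>{u..v}. h (\<phi> r) \<in> A)"
proof -
  have "continuous_on {0<..<T} (\<lambda>r. h (\<phi> r))"
    by (intro continuous_on_h continuous_on_subset[OF cont]) auto
  then have "open ({0<..<T} \<inter> (\<lambda>r. h (\<phi> r)) -` A)"
    using \<open>open A\<close> by (intro continuous_open_preimage) auto
  moreover have "t \<in> {0<..<T} \<inter> (\<lambda>r. h (\<phi> r)) -` A" using assms by simp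
  ultimately obtain e where e: "e > 0" "cball t e \<subseteq> {0<..<T} \<inter> (\<lambda>r. h (\<phi> r)) -` A"
    unfolding open_contains_cball by blast
  then have *: "{t - e..t + e} \<subseteq> {0<..<T} \<inter> (\<lambda>r. h (\<phi> r)) -` A"
    by (simp add: cball_eq_atLeastAtMost)
  have "t - e \<in> {0<..<T}" "t + e \<in> {0<..<T}"
    by (rule IntD1[OF subsetD[OF *]]; use e(1) in simp)+
  with e(1) * show ?thesis
    by (intro exI[of _ "t - e"] exI[of _ "t + e"]) auto
qed

text \<open>The inclusion gives the velocity only off a null set. Changing it there yields the
  continuous integrand \<open>V (\<phi> r)\<close>, whose integral is differentiable at every
  interior time.\<close>

lemma has_derivative_of_field:
  assumes "0 \<le> u" "u < t" "t < v" "v \<le> T" and V: "continuous_on UNIV V"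
    and F: "\<And>r. r \<in> {u..v} \<Longrightarrow> filippov_field Z (\<phi> r) = {V (\<phi> r)}"
  shows "(\<phi> has_vector_derivative V (\<phi> t)) (at t)"
proof -
  obtain g N where g: "negligible N"
    "\<And>u v. 0 \<le> u \<Longrightarrow> u \<le> v \<Longrightarrow> v \<le> T \<Longrightarrow> (g has_integral (\<phi> v - \<phi> u)) {u..v}"
    "\<And>t. t \<in> {0..T} - N \<Longrightarrow> g t \<in> filippov_field Z (\<phi> t)"
    by (rule obtain_velocity) blast
  have contV: "continuous_on {u..v} (\<lambda>r. V (\<phi> r))"
    by (rule continuous_on_compose2[OF V]) (use assms(1,4) in \<open>auto intro: continuous_on_subset[OF cont]\<close>)
  have eq: "\<phi> u + integral {u..r} (\<lambda>r. V (\<phi> r)) = \<phi> r" if r: "r \<in> {u..v}" for r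
  proof -
    have "((\<lambda>r. V (\<phi> r)) has_integral (\<phi> r - \<phi> u)) {u..r}"
    proof (rule has_integral_spike[OF \<open>negligible N\<close>])
      show "(g has_integral (\<phi> r - \<phi> u)) {u..r}" using g(2) r assms(1,4) by auto
      show "V (\<phi> s) = g s" if "s \<in> {u..r} - N" for s
        using g(3)[of s] F[of s] that r assms(1,4) by auto
    qed
    then show ?thesis by (simp add: integral_unique)
  qed
  have "((\<lambda>r. \<phi> u + integral {u..r} (\<lambda>r. V (\<phi> r))) has_vector_derivative V (\<phi> t)) (at t within {u..v})"
    using integral_has_vector_derivative[OF contV, of t] assms(2,3)
    by (auto intro!: derivative_eq_intros)
  then have "(\<phi> has_vector_derivative V (\<phi> t)) (at t within {u..v})"
    by (rule has_vector_derivative_transform[rotated 2]) (use eq assms(2,3) in auto)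
  then show ?thesis by (simp only: at_within_Icc_at[OF assms(2,3)])
qed

lemma deriv_inside:
  assumes "t \<in> {0<..<T}" "h (\<phi> t) < 0"
  shows "(\<phi> has_vector_derivative fst Z (\<phi> t)) (at t)"
proof -
  have "h (\<phi> t) \<in> {..<0}" using assms(2) by simp
  then obtain u v where uv: "0 \<le> u" "u < t" "t < v" "v \<le> T" "\<forall>r\<in>{u..v}. h (\<phi> r) \<in> {..<0}"
    using h_neighbourhood[OF assms(1) open_lessThan] by blast
  show ?thesis
  proof (rule has_derivative_of_field[OF uv(1-4) cont_fst])
    show "filippov_field Z (\<phi> r) = {fst Z (\<phi> r)}" if "r \<in> {u..v}" for r
      using bspec[OF uv(5) that] by (simp add: filippov_field_def)
  qed
qed

lemma deriv_outside:
  assumes "t \<in> {0<..<T}" "h (\<phi> t) > 0"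
  shows "(\<phi> has_vector_derivative snd Z (\<phi> t)) (at t)"
proof -
  have "h (\<phi> t) \<in> {0<..}" using assms(2) by simp
  then obtain u v where uv: "0 \<le> u" "u < t" "t < v" "v \<le> T" "\<forall>r\<in>{u..v}. h (\<phi> r) \<in> {0<..}"
    using h_neighbourhood[OF assms(1) open_greaterThan] by blast
  show ?thesis
  proof (rule has_derivative_of_field[OF uv(1-4) cont_snd])
    show "filippov_field Z (\<phi> r) = {snd Z (\<phi> r)}" if "r \<in> {u..v}" for r
      using bspec[OF uv(5) that] by (simp add: filippov_field_def)
  qed
qed

text \<open>At a crossing point both fields share this sign: 1 for an exit from the disc, -1 for an
  entry.\<close>

definition crossing_sign :: "real \<Rightarrow> real" where
  "crossing_sign t = sgn (fst Z (\<phi> t) \<bullet> \<phi> t)"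

text \<open>Near a crossing point both fields, hence all their convex combinations, move
  \<open>h\<close> in the same direction at a rate bounded away from 0. The window is cut down to
  \<open>{0..T}\<close>, so hits at the end times are covered.\<close>

lemma transversal:
  assumes t: "t \<in> {0..T}" and hit: "h (\<phi> t) = 0"
  shows "crossing_sign t = 1 \<or> crossing_sign t = - 1"
    and "\<exists>d>0. \<forall>u v. 0 \<le> u \<longrightarrow> u < v \<longrightarrow> v \<le> T \<longrightarrow> \<bar>u - t\<bar> < d \<longrightarrow> \<bar>v - t\<bar> < d \<longrightarrow>
       crossing_sign t * h (\<phi> u) < crossing_sign t * h (\<phi> v)"
proof -
  define P where "P = \<phi> t"
  define \<sigma> where "\<sigma> = crossing_sign t"
  have "(fst Z P \<bullet> P) * (snd Z P \<bullet> P) > 0"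
    using cross[OF t] hit
    by (auto simp: P_def S1_iff crossing_region_def lie_h_def grad_h_def)
  then have \<sigma>: "\<sigma> = 1 \<or> \<sigma> = - 1" "\<sigma> * (fst Z P \<bullet> P) > 0" "\<sigma> * (snd Z P \<bullet> P) > 0"
    by (auto simp: \<sigma>_def crossing_sign_def P_def zero_less_mult_iff sgn_if)
  from \<sigma>(1) show "crossing_sign t = 1 \<or> crossing_sign t = - 1" by (simp add: \<sigma>_def)
  obtain m where m: "0 < m" "m < \<sigma> * (fst Z P \<bullet> P)" "m < \<sigma> * (snd Z P \<bullet> P)"
    using field_lbound_gt_zero[OF \<sigma>(2,3)] by blast
  \<comment> \<open>The velocity at an intermediate time is tested against the positions at
    \<open>u\<close> and \<open>v\<close>; hence an open set of pairs.\<close>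
  define Q where "Q = {(z, w). m < \<sigma> * (fst Z z \<bullet> w) \<and> m < \<sigma> * (snd Z z \<bullet> w)}"
  have "open Q"
    unfolding Q_def case_prod_unfold
    by (intro open_Collect_conj open_Collect_less continuous_intros
        continuous_on_compose2[OF cont_fst] continuous_on_compose2[OF cont_snd]) auto
  moreover have "(P, P) \<in> Q" using m by (simp add: Q_def)
  ultimately obtain A B where AB: "open A" "open B" "P \<in> A" "P \<in> B" "A \<times> B \<subseteq> Q"
    by (elim open_prod_elim) auto
  have "open (A \<inter> B)" "P \<in> A \<inter> B" using AB by auto
  then obtain e where e: "e > 0" "ball P e \<subseteq> A \<inter> B"
    by (meson open_contains_ball)
  obtain d where d: "d > 0" "\<And>r. r \<in> {0..T} \<Longrightarrow> dist r t < d \<Longrightarrow> dist (\<phi> r) P < e"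
    using cont t e(1) unfolding continuous_on_iff P_def by metis
  obtain g N where g: "negligible N"
    "\<And>u v. 0 \<le> u \<Longrightarrow> u \<le> v \<Longrightarrow> v \<le> T \<Longrightarrow> (g has_integral (\<phi> v - \<phi> u)) {u..v}"
    "\<And>t. t \<in> {0..T} - N \<Longrightarrow> g t \<in> filippov_field Z (\<phi> t)"
    by (rule obtain_velocity) blast
  have "\<sigma> * h (\<phi> u) < \<sigma> * h (\<phi> v)"
    if uv: "0 \<le> u" "u < v" "v \<le> T" "\<bar>u - t\<bar> < d" "\<bar>v - t\<bar> < d" for u v
  proof -
    have near: "\<phi> r \<in> ball P e" if "r \<in> {u..v}" for r
      using d(2)[of r] that uv by (auto simp: dist_commute dist_real_def)
    \<comment> \<open>\<open>h (\<phi> v) - h (\<phi> u)\<close> is the inner product of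
      \<open>\<phi> v - \<phi> u\<close> with \<open>\<phi> u + \<phi> v\<close>. The second vector
      is fixed, so the difference is the integral of a linear image of the velocity.\<close>
    define w where "w = \<sigma> *\<^sub>R (\<phi> u + \<phi> v)"
    have "((\<lambda>r. g r \<bullet> w) has_integral ((\<phi> v - \<phi> u) \<bullet> w)) {u..v}"
      using has_integral_linear[OF g(2)[of u v] bounded_linear_inner_left[of w]] uv by (simp add: o_def)
    then have 1: "((\<lambda>r. if r \<in> N then 2 * m else g r \<bullet> w) has_integral ((\<phi> v - \<phi> u) \<bullet> w)) {u..v}"
      by (rule has_integral_spike[OF g(1), rotated]) auto
    have 2: "((\<lambda>r. 2 * m) has_integral (2 * m * (v - u))) {u..v}"
      using has_integral_const_real[of "2 * m" u v] uv by (simp add: mult.commute)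
    have 3: "2 * m \<le> g r \<bullet> w" if r: "r \<in> {u..v} - N" for r
    proof (rule filippov_field_inner_ge)
      show "g r \<in> filippov_field Z (\<phi> r)" using g(3) r uv by auto
      have "(\<phi> r, \<phi> u) \<in> Q" "(\<phi> r, \<phi> v) \<in> Q"
        by (rule subsetD[OF AB(5)]; use near[of r] near[of u] near[of v] r uv e(2) in auto)+
      then show "2 * m \<le> fst Z (\<phi> r) \<bullet> w" "2 * m \<le> snd Z (\<phi> r) \<bullet> w"
        by (auto simp: Q_def w_def inner_add_right distrib_left)
    qed
    have "2 * m * (v - u) \<le> (\<phi> v - \<phi> u) \<bullet> w"
      by (rule has_integral_le[OF 2 1]) (use 3 in auto)
    also have "(\<phi> v - \<phi> u) \<bullet> w = \<sigma> * h (\<phi> v) - \<sigma> * h (\<phi> u)"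
      by (simp add: w_def h_inner algebra_simps inner_add_left inner_add_right inner_diff_left inner_diff_right inner_commute)
    finally show "\<sigma> * h (\<phi> u) < \<sigma> * h (\<phi> v)"
      using m(1) uv(2) mult_pos_pos[of "2 * m" "v - u"] by linarith
  qed
  with d(1) show "\<exists>d>0. \<forall>u v. 0 \<le> u \<longrightarrow> u < v \<longrightarrow> v \<le> T \<longrightarrow> \<bar>u - t\<bar> < d \<longrightarrow> \<bar>v - t\<bar> < d \<longrightarrow>
       crossing_sign t * h (\<phi> u) < crossing_sign t * h (\<phi> v)"
    unfolding \<sigma>_def by blast
qed

text \<open>Strict monotonicity of \<open>h\<close> near a hit isolates it, and compactness of
  \<open>{0..T}\<close> leaves finitely many.\<close>

lemma finite_hits: "finite {t \<in> {0..T}. h (\<phi> t) = 0}"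
proof -
  let ?B = "{t \<in> {0..T}. h (\<phi> t) = 0}"
  have "closed ({0..T} \<inter> (\<lambda>t. h (\<phi> t)) -` {0})"
    by (intro continuous_closed_preimage continuous_on_h cont) auto
  then have closed: "closed ?B" by (simp add: vimage_def Int_def)
  have "\<not> t islimpt ?B" if tT: "t \<in> {0..T}" for t
  proof
    assume lim: "t islimpt ?B"
    then have "t \<in> ?B" using closed closed_limpt by blast
    then have hit: "h (\<phi> t) = 0" by simp
    obtain d where d: "d > 0"
      "\<And>u v. 0 \<le> u \<Longrightarrow> u < v \<Longrightarrow> v \<le> T \<Longrightarrow> \<bar>u - t\<bar> < d \<Longrightarrow> \<bar>v - t\<bar> < d \<Longrightarrow>
         crossing_sign t * h (\<phi> u) < crossing_sign t * h (\<phi> v)"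
      using transversal(2)[OF tT hit] by blast
    obtain r where r: "r \<in> ?B" "r \<noteq> t" "dist r t < d"
      using lim d(1) unfolding islimpt_approachable by blast
    show False
      using d(2)[of r t] d(2)[of t r] r hit tT d(1) by (cases "r < t") (auto simp: dist_real_def)
  qed
  then have "finite ({0..T} \<inter> ?B)"
    by (intro finite_not_islimpt_in_compact) auto
  moreover have "{0..T} \<inter> ?B = ?B" by blast
  ultimately show ?thesis by simp
qed

text \<open>Just before an exit and just after an entry the trajectory is inside. Since it is
  closed, an exit at time 0 can be read at \<open>T\<close>, and an entry at \<open>T\<close> at 0,
  so the required side lies in \<open>{0..T}\<close>.\<close>

lemma closed_hit_enters:
  assumes closed: "\<phi> 0 = \<phi> T" and t: "t \<in> {0..T}" and hit: "h (\<phi> t) = 0"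
  obtains r where "r \<in> {0<..<T}" "h (\<phi> r) < 0"
proof -
  consider "crossing_sign t = 1" | "crossing_sign t = - 1"
    using transversal(1)[OF t hit] by blast
  then show thesis
  proof cases
    case 1
    define t' where "t' = (if t = 0 then T else t)"
    have t': "t' \<in> {0<..T}" "\<phi> t' = \<phi> t" using t closed T_pos by (auto simp: t'_def)
    have sign: "crossing_sign t' = 1" using 1 t'(2) by (simp add: crossing_sign_def)
    have "t' \<in> {0..T}" "h (\<phi> t') = 0" using t' hit by auto
    then obtain d where d: "d > 0"
      "\<And>u v. 0 \<le> u \<Longrightarrow> u < v \<Longrightarrow> v \<le> T \<Longrightarrow> \<bar>u - t'\<bar> < d \<Longrightarrow> \<bar>v - t'\<bar> < d \<Longrightarrow>
         crossing_sign t' * h (\<phi> u) < crossing_sign t' * h (\<phi> v)"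
      using transversal(2) by metis
    define r where "r = max (t' / 2) (t' - d / 2)"
    have "0 < r" "r < t'" "\<bar>r - t'\<bar> < d" using t' d(1) by (auto simp: r_def)
    then show thesis using d(2)[of r t'] t' hit d(1) sign that[of r] by simp
  next
    case 2
    define t' where "t' = (if t = T then 0 else t)"
    have t': "t' \<in> {0..<T}" "\<phi> t' = \<phi> t" using t closed T_pos by (auto simp: t'_def)
    have sign: "crossing_sign t' = - 1" using 2 t'(2) by (simp add: crossing_sign_def)
    have "t' \<in> {0..T}" "h (\<phi> t') = 0" using t' hit by auto
    then obtain d where d: "d > 0"
      "\<And>u v. 0 \<le> u \<Longrightarrow> u < v \<Longrightarrow> v \<le> T \<Longrightarrow> \<bar>u - t'\<bar> < d \<Longrightarrow> \<bar>v - t'\<bar> < d \<Longrightarrow>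
         crossing_sign t' * h (\<phi> u) < crossing_sign t' * h (\<phi> v)"
      using transversal(2) by metis
    define r where "r = min ((t' + T) / 2) (t' + d / 2)"
    have "t' < r" "r < T" "\<bar>r - t'\<bar> < d" using t' d(1) by (auto simp: r_def min_def)
    then show thesis using d(2)[of t' r] t' hit d(1) sign that[of r] by simp
  qed
qed

end

section \<open>Concatenated arcs as Filippov trajectories\<close>

lemma fst_snd_in_filippov_field:
  "h z \<le> 0 \<Longrightarrow> fst Z z \<in> filippov_field Z z" "h z \<ge> 0 \<Longrightarrow> snd Z z \<in> filippov_field Z z"
  by (auto simp: filippov_field_def hull_inc)

text \<open>Off the finitely many joints the curve has a derivative lying in the Filippov set; the
  fundamental theorem with finitely many exceptions recovers the curve as its integral.\<close>

lemma crossing_periodic_orbit_trajectory: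
  assumes "crossing_periodic_orbit Z \<gamma>"
    and cont: "continuous_on UNIV (fst Z)" "continuous_on UNIV (snd Z)"
  obtains \<phi> T where "T > 0" "filippov_trajectory Z \<phi> 0 T" "\<phi> 0 = \<phi> T"
    "\<exists>t\<in>{0..T}. \<phi> t \<noteq> \<phi> 0" "\<gamma> = \<phi> ` {0..T}" "\<gamma> \<inter> S1 \<subseteq> crossing_region Z"
proof -
  obtain \<phi> T n s where orb: "T > 0" "s 0 = 0" "s (n::nat) = T"
    "\<And>i. i < n \<Longrightarrow> s i < s (Suc i) \<and>
       (arc_of (fst Z) \<phi> (s i) (s (Suc i)) \<and> (\<forall>t\<in>{s i..s (Suc i)}. h (\<phi> t) \<le> 0) \<or>
        arc_of (snd Z) \<phi> (s i) (s (Suc i)) \<and> (\<forall>t\<in>{s i..s (Suc i)}. h (\<phi> t) \<ge> 0))"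
    "\<phi> 0 = \<phi> T" "\<exists>t\<in>{0..T}. \<phi> t \<noteq> \<phi> 0" "\<gamma> = \<phi> ` {0..T}" "\<gamma> \<inter> S1 \<subseteq> crossing_region Z"
    using assms(1) unfolding crossing_periodic_orbit_def by blast
  \<comment> \<open>Induction over the arcs. The velocity is recorded as an element of the Filippov
    set for the inclusion, and as one of the two field values for the bound giving absolute
    integrability.\<close>
  have pieces: "0 \<le> s i \<and> continuous_on {0..s i} \<phi> \<and>
      (\<forall>t\<in>{0..s i} - s ` {..n}. \<exists>v. (\<phi> has_vector_derivative v) (at t) \<and>
         v \<in> {fst Z (\<phi> t), snd Z (\<phi> t)} \<inter> filippov_field Z (\<phi> t))" if "i \<le> n" for i
    using that
  proof (induction i)
    case 0
    show ?case using orb(2) by auto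
  next
    case (Suc i)
    let ?I = "{s i..s (Suc i)}"
    have le: "s i < s (Suc i)" using orb(4)[of i] Suc.prems by simp
    let ?P = "\<lambda>V. arc_of V \<phi> (s i) (s (Suc i)) \<and>
        (\<forall>t\<in>?I. V (\<phi> t) \<in> {fst Z (\<phi> t), snd Z (\<phi> t)} \<inter> filippov_field Z (\<phi> t))"
    have "?P (fst Z) \<or> ?P (snd Z)"
      using orb(4)[of i] Suc.prems fst_snd_in_filippov_field[of _ Z] by fastforce
    then have "\<exists>V. ?P V" by blast
    then obtain V where V: "\<And>t. t \<in> ?I \<Longrightarrow> (\<phi> has_vector_derivative V (\<phi> t)) (at t within ?I)"
      "\<And>t. t \<in> ?I \<Longrightarrow> V (\<phi> t) \<in> {fst Z (\<phi> t), snd Z (\<phi> t)} \<inter> filippov_field Z (\<phi> t)"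
      unfolding arc_of_def by blast
    have IH: "0 \<le> s i" "continuous_on {0..s i} \<phi>"
      "\<And>t. t \<in> {0..s i} - s ` {..n} \<Longrightarrow> \<exists>v. (\<phi> has_vector_derivative v) (at t) \<and>
         v \<in> {fst Z (\<phi> t), snd Z (\<phi> t)} \<inter> filippov_field Z (\<phi> t)"
      using Suc.IH Suc.prems by simp_all
    have ivl: "{0..s (Suc i)} = {0..s i} \<union> ?I" using le IH(1) by auto
    have "continuous_on ?I \<phi>"
      using V(1) has_vector_derivative_continuous by (force simp: continuous_on_eq_continuous_within)
    then have "continuous_on {0..s (Suc i)} \<phi>"
      unfolding ivl using IH(2) by (intro continuous_on_closed_Un) auto
    moreover have "\<exists>v. (\<phi> has_vector_derivative v) (at t) \<and>
         v \<in> {fst Z (\<phi> t), snd Z (\<phi> t)} \<inter> filippov_field Z (\<phi> t)"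
      if t: "t \<in> {0..s (Suc i)} - s ` {..n}" for t
    proof (cases "t \<le> s i")
      case True
      then show ?thesis using t by (intro IH(3)) auto
    next
      case False
      have "t \<noteq> s (Suc i)" using t Suc.prems by blast
      then have t': "s i < t" "t < s (Suc i)" using False t by auto
      then have "(\<phi> has_vector_derivative V (\<phi> t)) (at t)"
        using V(1)[of t] by (simp add: at_within_Icc_at)
      then show ?thesis using V(2)[of t] t' by auto
    qed
    moreover have "0 \<le> s (Suc i)" using IH(1) le by simp
    ultimately show ?case by blast
  qed
  define S where "S = s ` {..n}"
  have "finite S" by (simp add: S_def)
  have contT: "continuous_on {0..T} \<phi>" using pieces[of n] orb(3) by simp
  have "\<forall>t\<in>{0..T} - S. \<exists>v. (\<phi> has_vector_derivative v) (at t) \<and>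
         v \<in> {fst Z (\<phi> t), snd Z (\<phi> t)} \<inter> filippov_field Z (\<phi> t)"
    using pieces[of n] orb(3) by (simp add: S_def)
  from bchoice[OF this] obtain g0 where "\<forall>t\<in>{0..T} - S. (\<phi> has_vector_derivative g0 t) (at t) \<and>
      g0 t \<in> {fst Z (\<phi> t), snd Z (\<phi> t)} \<inter> filippov_field Z (\<phi> t)" ..
  then have g0: "\<And>t. t \<in> {0..T} - S \<Longrightarrow> (\<phi> has_vector_derivative g0 t) (at t)"
    "\<And>t. t \<in> {0..T} - S \<Longrightarrow> g0 t \<in> {fst Z (\<phi> t), snd Z (\<phi> t)}"
    "\<And>t. t \<in> {0..T} - S \<Longrightarrow> g0 t \<in> filippov_field Z (\<phi> t)"
    by blast+
  define g where "g = (\<lambda>t. if t \<in> S then 0 else g0 t)"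
  have int: "(g has_integral (\<phi> t - \<phi> 0)) {0..t}" if "t \<in> {0..T}" for t
    using that by (intro fundamental_theorem_of_calculus_interior_strong[OF \<open>finite S\<close>])
      (auto simp: g_def intro!: g0(1) continuous_on_subset[OF contT])
  have "continuous_on {0..T} (\<lambda>t. norm (fst Z (\<phi> t)) + norm (snd Z (\<phi> t)))"
    by (intro continuous_intros continuous_on_compose2[OF cont(1) contT] continuous_on_compose2[OF cont(2) contT]) auto
  then have bint: "(\<lambda>t. norm (fst Z (\<phi> t)) + norm (snd Z (\<phi> t))) integrable_on {0..T}"
    by (rule integrable_continuous_real)
  have "g absolutely_integrable_on {0..T}"
  proof (rule absolutely_integrable_integrable_bound[OF _ _ bint])
    show "norm (g t) \<le> norm (fst Z (\<phi> t)) + norm (snd Z (\<phi> t))" if "t \<in> {0..T}" for t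
      using g0(2)[of t] that by (auto simp: g_def)
    show "g integrable_on {0..T}" using int[of T] orb(1) by auto
  qed
  moreover have "negligible S" using \<open>finite S\<close> by (rule negligible_finite)
  moreover have "\<phi> t = \<phi> 0 + integral {0..t} g" if "t \<in> {0..T}" for t
    using integral_unique[OF int[OF that]] by simp
  moreover have "g t \<in> filippov_field Z (\<phi> t)" if "t \<in> {0..T} - S" for t
    using g0(3)[OF that] that by (simp add: g_def)
  ultimately have "filippov_trajectory Z \<phi> 0 T"
    unfolding filippov_trajectory_def by blast
  then show thesis using that orb by blast
qed

section \<open>The fields and the cycle as a point set\<close>

definition center_matrix :: "real^2^2" where
  "center_matrix = vector [vector [- 1, - 2], vector [1, 1]]"

text \<open>The singularity of the outer field is \<open>(-4/3, 4/3)\<close>. The offset 4/3 exceeds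
  half the square root of 5, which is what \<open>disc_bound\<close> needs, and makes the radius
  rational: 1 + 16/9 = 25/9.\<close>

definition cycle_field :: pwfield where
  "cycle_field = (\<lambda>z. vector [1, 0], \<lambda>z. center_matrix *v z + vector [4/3, 0])"

lemma fst_cycle_field [simp]: "fst cycle_field z $ 1 = 1" "fst cycle_field z $ 2 = 0"
  by (simp_all add: cycle_field_def)

lemma snd_cycle_field [simp]:
  "snd cycle_field z $ 1 = 4/3 - z $ 1 - 2 * z $ 2" "snd cycle_field z $ 2 = z $ 1 + z $ 2"
  by (simp_all add: cycle_field_def center_matrix_def matrix_vector_mult_def sum_2)

lemma continuous_cycle_field:
  "continuous_on UNIV (fst cycle_field)" "continuous_on UNIV (snd cycle_field)"
  unfolding cycle_field_def by (auto intro!: continuous_intros)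

lemma center_type_center_matrix: "center_type center_matrix"
proof -
  \<comment> \<open>The matrix has trace 0 and determinant 1, so its eigenvalues are
    \<open>\<i>\<close> and \<open>- \<i>\<close>; the second row of the eigenvector equation gives
    \<open>w\<close>.\<close>
  define w :: "complex^2" where "w = vector [\<i> - 1, 1]"
  have "map_matrix complex_of_real center_matrix *v w = \<i> *s w"
    by (simp add: vec_eq_iff forall_2 w_def matrix_vector_mult_def map_matrix_def sum_2 center_matrix_def algebra_simps)
  moreover have "w \<noteq> 0" by (auto simp: w_def vec_eq_iff forall_2)
  ultimately show ?thesis
    unfolding center_type_def complex_eigenvalue_def by (intro exI[of _ 1]) auto
qed

lemma cycle_field_in_X_S1_0: "cycle_field \<in> X_S1_0"
  using center_type_center_matrix unfolding X_S1_0_def cycle_field_def by blast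

definition zeta :: "real^2 \<Rightarrow> complex" where
  "zeta z = of_real (z $ 1 + z $ 2) + \<i> * of_real (z $ 2 - 4/3)"

lemma zeta_sel [simp]: "Re (zeta z) = z $ 1 + z $ 2" "Im (zeta z) = z $ 2 - 4/3"
  by (simp_all add: zeta_def)

lemma zeta_eq_iff: "zeta z = zeta z' \<longleftrightarrow> z = z'"
  by (auto simp: complex_eq_iff vec_eq_iff forall_2)

text \<open>The first integral \<open>(cmod (zeta z))^2\<close> of the outer field, minus its common
  value at \<open>(1, 0)\<close> and \<open>(-1, 0)\<close>, the ends of the diameter.\<close>

definition energy :: "real^2 \<Rightarrow> real" where
  "energy z = (z $ 1 + z $ 2)\<^sup>2 + (z $ 2 - 4/3)\<^sup>2 - 25/9"

lemma energy_eq_h: "energy z = h z + z $ 2 * (2 * z $ 1 + z $ 2 - 8/3)"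
  by (simp add: energy_def h_def power2_eq_square algebra_simps)

text \<open>The correction by \<open>h\<close> acts only inside the disc and vanishes on the circle,
  so the function is continuous across it.\<close>

definition potential :: "real^2 \<Rightarrow> real" where
  "potential z = energy z - min (h z) 0"

definition cycle :: "(real^2) set" where
  "cycle = {z. h z \<le> 0 \<and> z $ 2 = 0 \<or> h z \<ge> 0 \<and> energy z = 0}"

text \<open>Cauchy-Schwarz in the form of Lagrange's identity: on the unit disc
  \<open>2x + y\<close> is at most the square root of 5, and 5 < 64/9.\<close>

lemma disc_bound:
  assumes "h z \<le> 0"
  shows "2 * z $ 1 + z $ 2 < 8/3"
proof -
  have "(2 * z $ 1 + z $ 2)\<^sup>2 + (z $ 1 - 2 * z $ 2)\<^sup>2 = 5 * (h z + 1)"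
    by (simp add: h_def power2_eq_square algebra_simps)
  then have "(2 * z $ 1 + z $ 2)\<^sup>2 \<le> 5"
    using assms zero_le_power2[of "z $ 1 - 2 * z $ 2"] by (smt (verit))
  then have "(2 * z $ 1 + z $ 2)\<^sup>2 < (8/3)\<^sup>2" by (simp add: power2_eq_square)
  then show ?thesis by (rule power2_less_imp_less) simp
qed

lemma potential_zero_imp_cycle:
  assumes "potential z = 0"
  shows "z \<in> cycle"
proof (cases "h z \<le> 0")
  case True
  then have "z $ 2 * (2 * z $ 1 + z $ 2 - 8/3) = 0"
    using assms by (simp add: potential_def energy_eq_h)
  then have "z $ 2 = 0" using disc_bound[OF True] by auto
  then show ?thesis using True by (simp add: cycle_def)
next
  case False
  then show ?thesis using assms by (simp add: potential_def cycle_def)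
qed

text \<open>Below the axis, \<open>energy z = 0\<close> forces \<open>x + y < 1\<close> and
  \<open>-y \<le> 1/3\<close>, so the second factor in \<open>energy_eq_h\<close> is negative like
  \<open>y\<close>. Their product is then positive and \<open>h\<close> must be negative.\<close>

lemma cycle_outside_upper:
  assumes "energy z = 0" "h z \<ge> 0"
  shows "z $ 2 \<ge> 0"
proof (rule ccontr)
  assume "\<not> z $ 2 \<ge> 0"
  then have neg: "z $ 2 < 0" by simp
  have circle: "(z $ 1 + z $ 2)\<^sup>2 + (4/3 - z $ 2)\<^sup>2 = 25/9"
    using assms(1) power2_commute[of "z $ 2" "4/3"] by (simp add: energy_def)
  have "(4/3 - z $ 2)\<^sup>2 > (4/3)\<^sup>2"
    using neg by (intro power_strict_mono) auto
  also have "(4/3 :: real)\<^sup>2 = 25/9 - 1\<^sup>2" by (simp add: power2_eq_square)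
  finally have "(z $ 1 + z $ 2)\<^sup>2 < 1\<^sup>2"
    using circle by (smt (verit))
  then have w: "z $ 1 + z $ 2 < 1" by (rule power2_less_imp_less) simp
  have "(5/3 :: real)\<^sup>2 = 25/9" by (simp add: power2_eq_square)
  then have "(4/3 - z $ 2)\<^sup>2 \<le> (5/3)\<^sup>2"
    using circle zero_le_power2[of "z $ 1 + z $ 2"] by (smt (verit))
  then have "4/3 - z $ 2 \<le> 5/3" by (rule power2_le_imp_le) simp
  with w have "2 * z $ 1 + z $ 2 - 8/3 < 0" by linarith
  then have "z $ 2 * (2 * z $ 1 + z $ 2 - 8/3) > 0" using neg by (rule mult_neg_neg[rotated])
  then show False using assms energy_eq_h[of z] by simp
qed

text \<open>In the coordinate \<open>zeta\<close> the cycle lies on the boundary of a convex set: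
  the disc of radius 5/3 cut off at height -4/3. The origin is interior to that set.\<close>

lemma cycle_norm_bounds:
  assumes "z \<in> cycle"
  shows "Im (zeta z) \<ge> - 4/3" "(cmod (zeta z))\<^sup>2 \<le> 25/9"
    "Im (zeta z) = - 4/3 \<or> (cmod (zeta z))\<^sup>2 = 25/9"
proof -
  have "h z \<le> 0 \<Longrightarrow> z $ 2 = 0 \<Longrightarrow> energy z \<le> 0" by (simp add: energy_eq_h)
  then show "Im (zeta z) \<ge> - 4/3" "(cmod (zeta z))\<^sup>2 \<le> 25/9"
    "Im (zeta z) = - 4/3 \<or> (cmod (zeta z))\<^sup>2 = 25/9"
    using assms cycle_outside_upper[of z] by (auto simp: cycle_def energy_def cmod_power2)
qed

text \<open>A ray from an interior point leaves a convex set once. The inner claim \<open>le\<close>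
  says that no point of the cycle lies farther out on a ray than another; applied in both orders it
  gives \<open>r = 1\<close>.\<close>

lemma cycle_ray_unique:
  assumes z: "z \<in> cycle" and z': "z' \<in> cycle" and "r \<ge> 0" and eq: "zeta z = r *\<^sub>R zeta z'"
  shows "z = z'"
proof -
  have le: "s \<le> 1" if uu: "u \<in> cycle" "u' \<in> cycle" "s \<ge> 0" "zeta u = s *\<^sub>R zeta u'" for u u' s
  proof -
    consider "Im (zeta u') = - 4/3" | "(cmod (zeta u'))\<^sup>2 = 25/9"
      using cycle_norm_bounds(3)[OF uu(2)] by blast
    then show ?thesis
    proof cases
      case 1
      then have "- 4/3 \<le> s * (- 4/3)"
        using cycle_norm_bounds(1)[OF uu(1)] uu(4) by simp
      then show ?thesis by simp
    next
      case 2
      have "s\<^sup>2 * (25/9) \<le> 25/9"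
        using cycle_norm_bounds(2)[OF uu(1)] uu(4) 2 by (simp add: power_mult_distrib)
      then have "s\<^sup>2 \<le> 1\<^sup>2" by simp
      then show ?thesis by (rule power2_le_imp_le) simp
    qed
  qed
  have "zeta z \<noteq> 0" using cycle_norm_bounds(3)[OF z] by (auto simp del: zeta_sel)
  then have "r > 0" using eq \<open>r \<ge> 0\<close> by (cases "r = 0") auto
  then have "1 / r \<le> 1" using eq z z' by (intro le[of z' z]) auto
  moreover have "r \<le> 1" using assms by (intro le[of z z'])
  ultimately have "r = 1" using \<open>r > 0\<close> by simp
  then show ?thesis using eq by (simp add: zeta_eq_iff)
qed

lemma cycle_hits: "cycle \<inter> S1 = {vector [1, 0], vector [- 1, 0]}"
proof (rule set_eqI)
  fix z
  have "z \<in> cycle \<inter> S1 \<longleftrightarrow> h z = 0 \<and> z $ 2 = 0"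
    using disc_bound[of z] by (auto simp: cycle_def S1_iff energy_eq_h)
  also have "\<dots> \<longleftrightarrow> z $ 2 = 0 \<and> (z $ 1 = 1 \<or> z $ 1 = - 1)"
    by (auto simp: h_def power2_eq_1_iff)
  also have "\<dots> \<longleftrightarrow> z \<in> {vector [1, 0], vector [- 1, 0]}"
    by (auto simp: vec_eq_iff forall_2)
  finally show "z \<in> cycle \<inter> S1 \<longleftrightarrow> z \<in> {vector [1, 0], vector [- 1, 0]}" .
qed

text \<open>Both fields have positive first component at the two points (1 for the inner one, 1/3
  and 7/3 for the outer one): both exit at \<open>(1, 0)\<close> and both enter at
  \<open>(-1, 0)\<close>.\<close>

lemma cycle_hits_crossing: "cycle \<inter> S1 \<subseteq> crossing_region cycle_field"
  unfolding cycle_hits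
  by (auto simp: crossing_region_def lie_h_def grad_h_def inner_vec_def sum_2 S1_def)

section \<open>Closed trajectories: the potential and the argument\<close>

locale closed_trajectory = crossing_trajectory cycle_field \<phi> T for \<phi> T +
  assumes closed: "\<phi> 0 = \<phi> T"
begin

lemma coordinate_derivs:
  assumes "t \<in> {0<..<T}"
  shows "h (\<phi> t) < 0 \<Longrightarrow> ((\<lambda>t. \<phi> t $ 1) has_real_derivative 1) (at t)"
    and "h (\<phi> t) < 0 \<Longrightarrow> ((\<lambda>t. \<phi> t $ 2) has_real_derivative 0) (at t)"
    and "h (\<phi> t) > 0 \<Longrightarrow> ((\<lambda>t. \<phi> t $ 1) has_real_derivative 4/3 - \<phi> t $ 1 - 2 * \<phi> t $ 2) (at t)"
    and "h (\<phi> t) > 0 \<Longrightarrow> ((\<lambda>t. \<phi> t $ 2) has_real_derivative \<phi> t $ 1 + \<phi> t $ 2) (at t)"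
  using bounded_linear.has_vector_derivative[OF bounded_linear_vec_nth deriv_inside[OF assms], of 1]
    bounded_linear.has_vector_derivative[OF bounded_linear_vec_nth deriv_inside[OF assms], of 2]
    bounded_linear.has_vector_derivative[OF bounded_linear_vec_nth deriv_outside[OF assms], of 1]
    bounded_linear.has_vector_derivative[OF bounded_linear_vec_nth deriv_outside[OF assms], of 2]
  by (simp_all add: has_real_derivative_iff_has_vector_derivative)

definition hits :: "real set" where
  "hits = {t \<in> {0..T}. h (\<phi> t) = 0}"

lemma finite_hits': "finite hits"
  unfolding hits_def by (rule finite_hits)

lemma off_hits:
  assumes "t \<in> {0<..<T} - hits"
  shows "t \<in> {0<..<T}" "h (\<phi> t) < 0 \<or> h (\<phi> t) > 0"
  using assms by (auto simp: hits_def)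

lemma continuous_on_potential: "continuous_on {0..T} (\<lambda>t. potential (\<phi> t))"
  unfolding potential_def energy_def by (intro continuous_intros cont)

text \<open>Along the inner field \<open>y (2x + y - 8/3)\<close> has derivative \<open>2y\<close>,
  of either sign. Squaring produces the factor \<open>y^2\<close>, and \<open>disc_bound\<close>
  then fixes the sign.\<close>

lemma potential_deriv_inside:
  assumes t: "t \<in> {0<..<T}" and neg: "h (\<phi> t) < 0"
  shows "((\<lambda>t. (potential (\<phi> t))\<^sup>2) has_real_derivative
    4 * (\<phi> t $ 2)\<^sup>2 * (2 * \<phi> t $ 1 + \<phi> t $ 2 - 8/3)) (at t)"
proof -
  have "h (\<phi> t) \<in> {..<0}" using neg by simp
  then obtain u v where uv: "0 \<le> u" "u < t" "t < v" "v \<le> T" "\<forall>r\<in>{u..v}. h (\<phi> r) \<in> {..<0}"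
    using h_neighbourhood[OF t open_lessThan] by blast
  have "((\<lambda>t. (\<phi> t $ 2 * (2 * \<phi> t $ 1 + \<phi> t $ 2 - 8/3))\<^sup>2) has_real_derivative
    4 * (\<phi> t $ 2)\<^sup>2 * (2 * \<phi> t $ 1 + \<phi> t $ 2 - 8/3)) (at t)"
    by (rule derivative_eq_intros coordinate_derivs(1,2)[OF t neg] refl)+
      (simp add: power2_eq_square)
  then show ?thesis
  proof (rule has_field_derivative_transform_within_open)
    show "open {u<..<v}" "t \<in> {u<..<v}" using uv by auto
    show "(\<phi> r $ 2 * (2 * \<phi> r $ 1 + \<phi> r $ 2 - 8/3))\<^sup>2 = (potential (\<phi> r))\<^sup>2" if "r \<in> {u<..<v}" for r
    proof -
      have "h (\<phi> r) < 0" using bspec[OF uv(5), of r] that by simp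
      then show ?thesis by (simp add: potential_def energy_eq_h)
    qed
  qed
qed

lemma potential_deriv_outside:
  assumes t: "t \<in> {0<..<T}" and pos: "h (\<phi> t) > 0"
  shows "((\<lambda>t. (potential (\<phi> t))\<^sup>2) has_real_derivative 0) (at t)"
proof -
  have "h (\<phi> t) \<in> {0<..}" using pos by simp
  then obtain u v where uv: "0 \<le> u" "u < t" "t < v" "v \<le> T" "\<forall>r\<in>{u..v}. h (\<phi> r) \<in> {0<..}"
    using h_neighbourhood[OF t open_greaterThan] by blast
  have "((\<lambda>t. (energy (\<phi> t))\<^sup>2) has_real_derivative 0) (at t)"
    unfolding energy_def
    by (rule derivative_eq_intros coordinate_derivs(3,4)[OF t pos] refl)+
      (simp add: algebra_simps)
  then show ?thesis
  proof (rule has_field_derivative_transform_within_open)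
    show "open {u<..<v}" "t \<in> {u<..<v}" using uv by auto
    show "(energy (\<phi> r))\<^sup>2 = (potential (\<phi> r))\<^sup>2" if "r \<in> {u<..<v}" for r
    proof -
      have "h (\<phi> r) > 0" using bspec[OF uv(5), of r] that by simp
      then show ?thesis by (simp add: potential_def)
    qed
  qed
qed

text \<open>The negated squared potential never decreases, so on a closed trajectory it is constant
  and its derivative vanishes at \<open>r\<close>. This forces \<open>y = 0\<close> there, hence
  potential 0 at \<open>r\<close> and, by constancy, at all times.\<close>

lemma inside_imp_subset_cycle:
  assumes r: "r \<in> {0<..<T}" "h (\<phi> r) < 0"
  shows "\<phi> ` {0..T} \<subseteq> cycle"
proof -
  define D where "D t = (if h (\<phi> t) < 0
    then - (4 * (\<phi> t $ 2)\<^sup>2 * (2 * \<phi> t $ 1 + \<phi> t $ 2 - 8/3)) else 0)" for t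
  define f where "f t = - (potential (\<phi> t))\<^sup>2" for t
  have cont_f: "continuous_on {0..T} f"
    unfolding f_def by (intro continuous_intros continuous_on_potential)
  have ends: "f 0 = f T" by (simp add: f_def closed)
  have D: "(f has_real_derivative D t) (at t) \<and> D t \<ge> 0" if t: "t \<in> {0<..<T} - hits" for t
  proof (cases "h (\<phi> t) < 0")
    case True
    have "2 * \<phi> t $ 1 + \<phi> t $ 2 - 8/3 \<le> 0" using disc_bound[of "\<phi> t"] True by simp
    then have "4 * (\<phi> t $ 2)\<^sup>2 * (2 * \<phi> t $ 1 + \<phi> t $ 2 - 8/3) \<le> 0"
      by (intro mult_nonneg_nonpos) auto
    then show ?thesis
      using DERIV_minus[OF potential_deriv_inside[OF off_hits(1)[OF t] True]] True
      by (simp add: D_def f_def[abs_def])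
  next
    case False
    then have "h (\<phi> t) > 0" using off_hits(2)[OF t] by simp
    then show ?thesis
      using DERIV_minus[OF potential_deriv_outside[OF off_hits(1)[OF t]]] False
      by (simp add: D_def f_def[abs_def])
  qed
  have const: "f t = f 0" if "t \<in> {0..T}" for t
    by (rule closed_nondecreasing_const(1)[OF finite_hits' cont_f ends D that])
  have "D r = 0"
    by (rule closed_nondecreasing_const(2)[OF finite_hits' cont_f ends D])
      (use r in \<open>auto simp: hits_def\<close>)
  moreover have "2 * \<phi> r $ 1 + \<phi> r $ 2 - 8/3 \<noteq> 0" using disc_bound[of "\<phi> r"] r by simp
  ultimately have "\<phi> r $ 2 = 0" using r by (auto simp: D_def)
  then have "f r = 0" using r by (simp add: f_def potential_def energy_eq_h)
  then have "f t = 0" if "t \<in> {0..T}" for t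
    using const[OF that] const[of r] r by simp
  then show ?thesis
    using potential_zero_imp_cycle by (auto simp: f_def)
qed

text \<open>If the ray were missed, \<open>zeta\<close> would stay in a slit plane with a continuous
  argument. That argument returns to its initial value although it increases along both fields.
  Admitting \<open>r = 0\<close> counts passage through the centre as a meeting.\<close>

lemma meets_ray:
  assumes "d \<noteq> 0"
  shows "\<exists>t\<in>{0..T}. \<exists>r\<ge>0. zeta (\<phi> t) = r *\<^sub>R d"
proof (rule ccontr)
  assume no: "\<not> ?thesis"
  \<comment> \<open>Division by \<open>- d\<close> turns the missed ray into the branch cut of
    \<open>Ln\<close>.\<close>
  define \<psi> where "\<psi> t = zeta (\<phi> t) / (- d)" for t
  have slit: "\<psi> t \<notin> \<real>\<^sub>\<le>\<^sub>0" if "t \<in> {0..T}" for t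
  proof
    assume "\<psi> t \<in> \<real>\<^sub>\<le>\<^sub>0"
    then obtain x where x: "\<psi> t = of_real x" "x \<le> 0" by (auto elim: nonpos_Reals_cases)
    have "zeta (\<phi> t) = \<psi> t * (- d)" using assms by (simp add: \<psi>_def)
    then have "zeta (\<phi> t) = (- x) *\<^sub>R d" by (simp add: x(1) scaleR_conv_of_real)
    then show False using x(2) no \<open>t \<in> {0..T}\<close> by (metis neg_0_le_iff_le)
  qed
  have nz: "zeta (\<phi> t) \<noteq> 0" if "t \<in> {0..T}" for t
    using slit[OF that] by (auto simp: \<psi>_def)
  define D where "D t = (if h (\<phi> t) < 0 then Im (1 / zeta (\<phi> t)) else 1)" for t
  define f where "f t = Im (Ln (\<psi> t))" for t
  have "continuous_on {0..T} \<psi>"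
    unfolding \<psi>_def zeta_def using assms by (intro continuous_intros cont) auto
  then have cont_f: "continuous_on {0..T} f"
    unfolding f_def using slit by (intro continuous_intros) auto
  have ends: "f 0 = f T" by (simp add: f_def \<psi>_def closed)
  have deriv_f: "(f has_real_derivative Im (c / zeta (\<phi> t))) (at t)"
    if t: "t \<in> {0..T}" and c: "((\<lambda>t. zeta (\<phi> t)) has_vector_derivative c) (at t)" for t c
  proof -
    have "(\<psi> has_vector_derivative c / (- d)) (at t)"
      unfolding \<psi>_def by (rule bounded_linear.has_vector_derivative[OF bounded_linear_divide c])
    from field_vector_diff_chain_at[OF this has_field_derivative_Ln[OF slit[OF t]]]
    have "((\<lambda>t. Ln (\<psi> t)) has_vector_derivative c / (- d) * inverse (\<psi> t)) (at t)"
      by (simp add: o_def)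
    moreover have "c / (- d) * inverse (\<psi> t) = c / zeta (\<phi> t)"
      using assms nz[OF t] by (simp add: \<psi>_def field_simps)
    ultimately have "((\<lambda>t. Ln (\<psi> t)) has_vector_derivative c / zeta (\<phi> t)) (at t)" by simp
    from bounded_linear.has_vector_derivative[OF bounded_linear_Im this]
    show ?thesis by (simp add: f_def[abs_def] has_real_derivative_iff_has_vector_derivative)
  qed
  have D: "(f has_real_derivative D t) (at t) \<and> D t > 0" if t: "t \<in> {0<..<T} - hits" for t
  proof (cases "h (\<phi> t) < 0")
    case True
    note t' = off_hits(1)[OF t]
    have "((\<lambda>t. zeta (\<phi> t)) has_vector_derivative of_real (1 + 0) + \<i> * of_real (0 - 0)) (at t)"
      unfolding zeta_def
      by (intro derivative_intros coordinate_derivs(1,2)[OF t' True])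
    then have 1: "((\<lambda>t. zeta (\<phi> t)) has_vector_derivative 1) (at t)" by simp
    \<comment> \<open>The disc lies below the height 4/3 of the centre, so \<open>zeta\<close> has
      negative and \<open>1 / zeta\<close> positive imaginary part.\<close>
    have "(\<phi> t $ 2)\<^sup>2 < 1\<^sup>2"
      using True zero_le_power2[of "\<phi> t $ 1"] unfolding h_def power_one by linarith
    then have "\<phi> t $ 2 < 1" by (rule power2_less_imp_less) simp
    then have "Im (zeta (\<phi> t)) < 0" by simp
    then have "Im (1 / zeta (\<phi> t)) > 0"
      using nz[of t] t' by (simp add: Im_divide divide_neg_pos sum_power2_gt_zero_iff complex_eq_iff del: zeta_sel)
    then show ?thesis using deriv_f[OF _ 1] t' True by (simp add: D_def)
  next
    case False
    note t' = off_hits(1)[OF t]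
    have pos: "h (\<phi> t) > 0" using off_hits(2)[OF t] False by simp
    have "((\<lambda>t. zeta (\<phi> t)) has_vector_derivative
        of_real ((4/3 - \<phi> t $ 1 - 2 * \<phi> t $ 2) + (\<phi> t $ 1 + \<phi> t $ 2)) +
        \<i> * of_real (\<phi> t $ 1 + \<phi> t $ 2 - 0)) (at t)"
      unfolding zeta_def
      by (intro derivative_intros coordinate_derivs(3,4)[OF t' pos])
    moreover have "of_real ((4/3 - \<phi> t $ 1 - 2 * \<phi> t $ 2) + (\<phi> t $ 1 + \<phi> t $ 2)) +
        \<i> * of_real (\<phi> t $ 1 + \<phi> t $ 2 - 0) = \<i> * zeta (\<phi> t)"
      by (simp add: complex_eq_iff)
    ultimately have 1: "((\<lambda>t. zeta (\<phi> t)) has_vector_derivative \<i> * zeta (\<phi> t)) (at t)" by simp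
    have "Im (\<i> * zeta (\<phi> t) / zeta (\<phi> t)) = 1" using nz[of t] t' by simp
    then show ?thesis using deriv_f[OF _ 1] t' False by (simp add: D_def)
  qed
  \<comment> \<open>Finitely many hits cannot exhaust the interval; at any other time the derivative
    would be both 0 and positive.\<close>
  have "infinite ({0<..<T} - hits)"
    using T_pos finite_hits' by (intro Diff_infinite_finite) (auto simp: infinite_Ioo)
  then have "{0<..<T} - hits \<noteq> {}" by (rule infinite_imp_nonempty)
  then obtain t where t: "t \<in> {0<..<T} - hits" by blast
  have "D t = 0"
    by (rule closed_nondecreasing_const(2)[OF finite_hits' cont_f ends _ t]) (use D less_imp_le in blast)
  then show False using D[OF t] by simp
qed

text \<open>The trajectory meets the ray through each point \<open>q\<close> of the cycle, and
  \<open>cycle_ray_unique\<close> identifies the meeting point with \<open>q\<close>.\<close>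

lemma subset_cycle_imp_eq:
  assumes "\<phi> ` {0..T} \<subseteq> cycle"
  shows "\<phi> ` {0..T} = cycle"
proof (intro equalityI assms subsetI)
  fix q assume q: "q \<in> cycle"
  have "zeta q \<noteq> 0" using cycle_norm_bounds(3)[OF q] by (auto simp del: zeta_sel)
  then obtain t r where t: "t \<in> {0..T}" and r: "r \<ge> 0" "zeta (\<phi> t) = r *\<^sub>R zeta q"
    using meets_ray by blast
  have "\<phi> t \<in> cycle" using assms t by blast
  then have "\<phi> t = q" using q r by (rule cycle_ray_unique)
  then show "q \<in> \<phi> ` {0..T}" using t by blast
qed

text \<open>Without an interior time inside the disc, continuity gives \<open>h \<ge> 0\<close> up
  to the end times, and a hit is impossible because it would lead inside.\<close>

lemma outside_or_cycle:
  obtains "\<phi> ` {0..T} = cycle" | "\<And>t. t \<in> {0..T} \<Longrightarrow> h (\<phi> t) > 0"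
proof (cases "\<exists>r\<in>{0<..<T}. h (\<phi> r) < 0")
  case True
  then show thesis using inside_imp_subset_cycle subset_cycle_imp_eq that(1) by blast
next
  case False
  have cl: "closure {0<..<T} = {0..T}" using T_pos by simp
  have "h (\<phi> t) \<ge> 0" if "t \<in> {0..T}" for t
    by (rule continuous_ge_on_closure[of "{0<..<T}"])
      (use that False in \<open>auto simp: cl not_less intro!: continuous_intros cont\<close>)
  moreover have "h (\<phi> t) \<noteq> 0" if "t \<in> {0..T}" for t
    using closed_hit_enters[OF closed that] False by blast
  ultimately show thesis by (intro that(2)) (simp add: less_le)
qed

end

section \<open>Uniqueness and existence of the crossing orbit\<close>

lemma crossing_periodic_orbit_eq_cycle:
  assumes "crossing_periodic_orbit cycle_field \<gamma>" "\<gamma> \<inter> S1 \<noteq> {}"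
  shows "\<gamma> = cycle"
proof -
  obtain \<phi> T where \<phi>: "T > 0" "filippov_trajectory cycle_field \<phi> 0 T" "\<phi> 0 = \<phi> T"
    "\<gamma> = \<phi> ` {0..T}" "\<gamma> \<inter> S1 \<subseteq> crossing_region cycle_field"
    using crossing_periodic_orbit_trajectory[OF assms(1) continuous_cycle_field] by metis
  interpret closed_trajectory \<phi> T
    by unfold_locales (use \<phi> continuous_cycle_field in auto)
  show ?thesis
  proof (rule outside_or_cycle)
    assume "\<And>t. t \<in> {0..T} \<Longrightarrow> h (\<phi> t) > 0"
    then show ?thesis using assms(2) \<phi>(4) by (force simp: S1_iff)
  qed (simp add: \<phi>(4))
qed

text \<open>An explicit parametrization is shown to be a crossing periodic orbit inside
  \<open>cycle\<close>. That its image is all of \<open>cycle\<close> then follows from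
  \<open>crossing_periodic_orbit_eq_cycle\<close>.\<close>

lemma crossing_periodic_orbit_cycle: "crossing_periodic_orbit cycle_field cycle"
proof -
  \<comment> \<open>In the coordinate \<open>zeta\<close> the points \<open>(1, 0)\<close> and
    \<open>(-1, 0)\<close> have modulus 5/3 and arguments \<open>- \<alpha>\<close> and
    \<open>pi + \<alpha>\<close>.\<close>
  obtain \<alpha> :: real where \<alpha>: "0 \<le> \<alpha>" "\<alpha> \<le> pi / 2" "cos \<alpha> = 3/5" "sin \<alpha> = 4/5"
    using sincos_total_pi_half[of "3/5" "4/5"] by (auto simp: power2_eq_square)
  define e1 e2 :: "real^2" where "e1 = vector [1, 0]" and "e2 = vector [0, 1]"
  \<comment> \<open>Time 2 along the diameter at unit speed, then angle
    \<open>pi + 2 * \<alpha>\<close> at unit angular speed; \<open>x\<close> and \<open>y\<close>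
    undo the shear.\<close>
  define T where "T = 2 + pi + 2 * \<alpha>"
  define y where "y t = 4/3 + 5/3 * sin (t - 2 - \<alpha>)" for t
  define x where "x t = 5/3 * cos (t - 2 - \<alpha>) - y t" for t
  define \<phi> where "\<phi> t = (if t \<le> 2 then (t - 1) *\<^sub>R e1 else x t *\<^sub>R e1 + y t *\<^sub>R e2)" for t
  have T: "2 < T" "0 < T" using \<alpha>(1) pi_gt_zero unfolding T_def by linarith+
  have y_start: "y 2 = 0" and x_start: "x 2 = 1" by (simp_all add: x_def y_def \<alpha>)
  have inner: "\<phi> t = (t - 1) *\<^sub>R e1" if "t \<in> {0..2}" for t
    using that by (simp add: \<phi>_def)
  have outer: "\<phi> t = x t *\<^sub>R e1 + y t *\<^sub>R e2" if "t \<in> {2..T}" for t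
    using that x_start y_start by (cases "t = 2") (auto simp: \<phi>_def)
  have y_nonneg: "y t \<ge> 0" if t: "t \<in> {2..T}" for t
  proof -
    define s where "s = t - 2 - \<alpha>"
    have s: "- \<alpha> \<le> s" "s \<le> pi + \<alpha>" using t by (auto simp: s_def T_def)
    have "sin s \<ge> - (4/5)"
    proof -
      consider "s < 0" | "0 \<le> s" "s \<le> pi" | "s > pi" by linarith
      then show ?thesis
      proof cases
        case 1
        have "sin (- s) \<le> sin \<alpha>" using 1 s \<alpha> by (intro sin_monotone_2pi_le) auto
        then show ?thesis using \<alpha> by simp
      next
        case 2
        then show ?thesis using sin_ge_zero[of s] by simp
      next
        case 3
        have "sin (s - pi) \<le> sin \<alpha>" using 3 s \<alpha> by (intro sin_monotone_2pi_le) auto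
        then show ?thesis using \<alpha> by simp
      qed
    qed
    then show ?thesis by (simp add: y_def s_def)
  qed
  have energy: "energy (\<phi> t) = 0" if "t \<in> {2..T}" for t
  proof -
    define c s where "c = cos (t - 2 - \<alpha>)" and "s = sin (t - 2 - \<alpha>)"
    have "energy (\<phi> t) = (5/3 * c)\<^sup>2 + (5/3 * s)\<^sup>2 - 25/9"
      by (simp add: outer[OF that] energy_def e1_def e2_def x_def y_def c_def s_def)
    also have "\<dots> = 25/9 * (s\<^sup>2 + c\<^sup>2 - 1)" by (simp add: power2_eq_square field_simps)
    finally show ?thesis by (simp add: c_def s_def)
  qed
  have h_inner: "h (\<phi> t) \<le> 0" if "t \<in> {0..2}" for t
  proof -
    have "\<bar>t - 1\<bar> \<le> 1" using that by auto
    then show ?thesis by (simp add: inner[OF that] h_def e1_def abs_square_le_1)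
  qed
  have h_outer: "h (\<phi> t) \<ge> 0" if t: "t \<in> {2..T}" for t
  proof -
    define c s where "c = cos (t - 2 - \<alpha>)" and "s = sin (t - 2 - \<alpha>)"
    \<comment> \<open>Cauchy-Schwarz again. The second factor of \<open>energy_eq_h\<close> equals
      \<open>5/3 * (2 * c - s) - 4\<close>, so 12/5 is exactly the bound that makes it
      nonpositive.\<close>
    have "(2 * c - s)\<^sup>2 + (c + 2 * s)\<^sup>2 = 5 * (s\<^sup>2 + c\<^sup>2)"
      by (simp add: power2_eq_square algebra_simps)
    then have "(2 * c - s)\<^sup>2 \<le> 5" by (simp add: c_def s_def) (smt (verit) zero_le_power2)
    also have "\<dots> \<le> (12/5)\<^sup>2" by (simp add: power2_eq_square)
    finally have "2 * c - s \<le> 12/5" by (rule power2_le_imp_le) simp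
    then have "2 * x t + y t - 8/3 \<le> 0" by (simp add: x_def y_def c_def s_def)
    then have "y t * (2 * x t + y t - 8/3) \<le> 0"
      using y_nonneg[OF t] by (intro mult_nonneg_nonpos)
    then show ?thesis
      using energy[OF t] energy_eq_h[of "\<phi> t"] by (simp add: outer[OF t] e1_def e2_def)
  qed
  have arc_inner: "arc_of (fst cycle_field) \<phi> 0 2"
    unfolding arc_of_def
  proof
    fix t :: real assume t: "t \<in> {0..2}"
    have "((\<lambda>t. (t - 1) *\<^sub>R e1) has_vector_derivative e1) (at t within {0..2})"
      by (auto intro!: derivative_eq_intros)
    then have "(\<phi> has_vector_derivative e1) (at t within {0..2})"
      by (rule has_vector_derivative_transform[rotated 2]) (use t inner in auto)
    then show "(\<phi> has_vector_derivative fst cycle_field (\<phi> t)) (at t within {0..2})"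
      by (simp add: cycle_field_def e1_def)
  qed
  have arc_outer: "arc_of (snd cycle_field) \<phi> 2 T"
    unfolding arc_of_def
  proof
    fix t :: real assume t: "t \<in> {2..T}"
    define c s where "c = cos (t - 2 - \<alpha>)" and "s = sin (t - 2 - \<alpha>)"
    have dy: "(y has_real_derivative 5/3 * c) (at t within {2..T})"
      unfolding y_def[abs_def] c_def by (auto intro!: derivative_eq_intros)
    have dx: "(x has_real_derivative - 5/3 * s - 5/3 * c) (at t within {2..T})"
      unfolding x_def[abs_def] s_def by (auto intro!: derivative_eq_intros dy)
    have "((\<lambda>t. x t *\<^sub>R e1 + y t *\<^sub>R e2) has_vector_derivative
        (- 5/3 * s - 5/3 * c) *\<^sub>R e1 + (5/3 * c) *\<^sub>R e2) (at t within {2..T})"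
      by (auto intro!: derivative_eq_intros dx dy)
    moreover have "(- 5/3 * s - 5/3 * c) *\<^sub>R e1 + (5/3 * c) *\<^sub>R e2 = snd cycle_field (\<phi> t)"
      by (simp add: vec_eq_iff forall_2 outer[OF t] e1_def e2_def x_def y_def c_def s_def)
    ultimately have "((\<lambda>t. x t *\<^sub>R e1 + y t *\<^sub>R e2) has_vector_derivative snd cycle_field (\<phi> t))
        (at t within {2..T})" by simp
    then show "(\<phi> has_vector_derivative snd cycle_field (\<phi> t)) (at t within {2..T})"
      by (rule has_vector_derivative_transform[rotated 2]) (use t outer in auto)
  qed
  have sub: "\<phi> ` {0..T} \<subseteq> cycle"
  proof clarify
    fix t assume "t \<in> {0..T}"
    then consider "t \<in> {0..2}" | "t \<in> {2..T}" by fastforce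
    then show "\<phi> t \<in> cycle"
    proof cases
      case 1
      then show ?thesis using h_inner[OF 1] by (simp add: cycle_def inner[OF 1] e1_def)
    next
      case 2
      then show ?thesis using h_outer[OF 2] energy[OF 2] by (simp add: cycle_def)
    qed
  qed
  have T_shift: "T - 2 - \<alpha> = \<alpha> + pi" by (simp add: T_def)
  have "y T = 0" "x T = - 1" unfolding x_def y_def T_shift by (simp_all add: \<alpha>)
  then have closed: "\<phi> 0 = \<phi> T" using outer[of T] inner[of 0] T by simp
  define \<tau> :: "nat \<Rightarrow> real" where "\<tau> i = (if i = 0 then 0 else if i = 1 then 2 else T)" for i
  have "crossing_periodic_orbit cycle_field (\<phi> ` {0..T})"
    unfolding crossing_periodic_orbit_def
  proof (intro exI conjI)
    show "T > 0" "\<tau> 0 = 0" "\<tau> 2 = T" "\<phi> 0 = \<phi> T" using T closed by (auto simp: \<tau>_def)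
    show "\<forall>i<2. \<tau> i < \<tau> (Suc i) \<and>
       (arc_of (fst cycle_field) \<phi> (\<tau> i) (\<tau> (Suc i)) \<and> (\<forall>t\<in>{\<tau> i..\<tau> (Suc i)}. h (\<phi> t) \<le> 0) \<or>
        arc_of (snd cycle_field) \<phi> (\<tau> i) (\<tau> (Suc i)) \<and> (\<forall>t\<in>{\<tau> i..\<tau> (Suc i)}. h (\<phi> t) \<ge> 0))"
    proof (intro allI impI)
      fix i :: nat assume "i < 2"
      then consider "i = 0" | "i = 1" by linarith
      then show "\<tau> i < \<tau> (Suc i) \<and>
       (arc_of (fst cycle_field) \<phi> (\<tau> i) (\<tau> (Suc i)) \<and> (\<forall>t\<in>{\<tau> i..\<tau> (Suc i)}. h (\<phi> t) \<le> 0) \<or>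
        arc_of (snd cycle_field) \<phi> (\<tau> i) (\<tau> (Suc i)) \<and> (\<forall>t\<in>{\<tau> i..\<tau> (Suc i)}. h (\<phi> t) \<ge> 0))"
        by cases (use arc_inner arc_outer h_inner h_outer T in \<open>simp_all add: \<tau>_def\<close>)
    qed
    have "\<phi> 1 \<noteq> \<phi> 0" by (simp add: inner e1_def vec_eq_iff forall_2)
    then show "\<exists>t\<in>{0..T}. \<phi> t \<noteq> \<phi> 0" using T by (intro bexI[of _ 1]) auto
    show "\<phi> ` {0..T} = \<phi> ` {0..T}" ..
    show "\<phi> ` {0..T} \<inter> S1 \<subseteq> crossing_region cycle_field"
      using sub cycle_hits_crossing by blast
  qed
  moreover have "\<phi> ` {0..T} \<inter> S1 \<noteq> {}"
  proof -
    have "\<phi> 0 \<in> \<phi> ` {0..T}" using T by (intro imageI) simp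
    moreover have "\<phi> 0 \<in> S1" by (simp add: inner S1_def e1_def)
    ultimately show ?thesis by blast
  qed
  ultimately show ?thesis
    using crossing_periodic_orbit_eq_cycle by metis
qed

section \<open>Isolation of the cycle\<close>

lemma closed_noncrossing: "closed {z \<in> S1. lie_h (fst cycle_field) z * lie_h (snd cycle_field) z \<le> 0}"
  unfolding S1_iff lie_h_def grad_h_def
  by (intro closed_Collect_conj closed_Collect_eq closed_Collect_le continuous_intros continuous_cycle_field)

text \<open>The ray from the centre \<open>zeta = 0\<close> in direction \<open>- \<i>\<close>,
  without its part in the open disc. That part must stay, since the cycle crosses the ray at the
  origin.\<close>

definition barrier :: "(real^2) set" where
  "barrier = {z. z $ 1 + z $ 2 = 0 \<and> z $ 2 \<le> 4/3 \<and> h z \<ge> 0}"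

lemma closed_barrier: "closed barrier"
  unfolding barrier_def
  by (intro closed_Collect_conj closed_Collect_eq closed_Collect_le continuous_intros)

text \<open>On the line \<open>x + y = 0\<close> the diameter contributes only the origin, where
  \<open>h\<close> is -1. On the outer arc \<open>y\<close> lies between 0 and 4/3, so
  \<open>(4/3 - y)^2\<close> is at most 16/9, short of 25/9.\<close>

lemma barrier_disjoint_cycle: "barrier \<inter> cycle = {}"
proof -
  have False if z: "z \<in> barrier" "z \<in> cycle" for z
  proof -
    have x: "z $ 1 = - z $ 2" "z $ 2 \<le> 4/3" "h z \<ge> 0" using z(1) by (auto simp: barrier_def)
    consider "h z \<le> 0" "z $ 2 = 0" | "energy z = 0" using z(2) by (auto simp: cycle_def)
    then show False
    proof cases
      case 1
      then show False using x by (simp add: h_def)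
    next
      case 2
      then have "z $ 2 \<ge> 0" using cycle_outside_upper x(3) by blast
      then have "(4/3 - z $ 2)\<^sup>2 \<le> (4/3)\<^sup>2" using x(2) by (intro power_mono) auto
      then show False
        using 2 x(1) power2_commute[of "z $ 2" "4/3"] by (simp add: energy_def power_divide)
    qed
  qed
  then show ?thesis by blast
qed

text \<open>Removing the noncrossing part of the circle makes every Filippov periodic orbit in
  \<open>U\<close>, sliding ones included, satisfy \<open>cross\<close>. Removing the barrier
  excludes those that stay outside the disc, since they meet its ray.\<close>

lemma crossing_limit_cycle_cycle: "crossing_limit_cycle cycle_field cycle"
proof -
  define U where "U = - ({z \<in> S1. lie_h (fst cycle_field) z * lie_h (snd cycle_field) z \<le> 0} \<union> barrier)"
  have "open U"
    unfolding U_def using closed_noncrossing closed_barrier by (intro open_Compl closed_Un)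
  moreover have "cycle \<subseteq> U"
    using cycle_hits_crossing barrier_disjoint_cycle by (force simp: U_def crossing_region_def)
  moreover have "\<delta> = cycle" if "periodic_orbit cycle_field \<delta>" "\<delta> \<subseteq> U" for \<delta>
  proof -
    obtain \<phi> T where \<phi>: "T > 0" "filippov_trajectory cycle_field \<phi> 0 T" "\<phi> 0 = \<phi> T" "\<delta> = \<phi> ` {0..T}"
      using \<open>periodic_orbit cycle_field \<delta>\<close> unfolding periodic_orbit_def by blast
    have in_U: "\<phi> t \<in> U" if "t \<in> {0..T}" for t using that \<open>\<delta> \<subseteq> U\<close> \<phi>(4) by blast
    interpret closed_trajectory \<phi> T
    proof unfold_locales
      show "\<phi> t \<in> crossing_region cycle_field" if "t \<in> {0..T}" "\<phi> t \<in> S1" for t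
        using in_U[OF that(1)] that(2) by (auto simp: U_def crossing_region_def)
    qed (use \<phi> continuous_cycle_field in auto)
    show ?thesis
    proof (rule outside_or_cycle)
      assume outside: "\<And>t. t \<in> {0..T} \<Longrightarrow> h (\<phi> t) > 0"
      obtain t r where t: "t \<in> {0..T}" "r \<ge> 0" "zeta (\<phi> t) = r *\<^sub>R (- \<i>)"
        using meets_ray[of "- \<i>"] by auto
      then have "\<phi> t \<in> barrier"
        using outside[OF t(1)] by (auto simp: barrier_def complex_eq_iff)
      then show ?thesis using in_U[OF t(1)] by (simp add: U_def)
    qed (simp add: \<phi>(4))
  qed
  ultimately show ?thesis
    unfolding crossing_limit_cycle_def using crossing_periodic_orbit_cycle by blast
qed

theorem corollary4:
  shows "\<exists>Z \<in> X_S1_0. \<exists>!\<gamma>. crossing_limit_cycle Z \<gamma> \<and> card (\<gamma> \<inter> S1) = 2"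
proof (rule bexI[OF _ cycle_field_in_X_S1_0], rule ex1I)
  have "vector [1, 0] \<noteq> (vector [- 1, 0] :: real^2)" by (simp add: vec_eq_iff forall_2)
  then show "crossing_limit_cycle cycle_field cycle \<and> card (cycle \<inter> S1) = 2"
    using crossing_limit_cycle_cycle by (simp add: cycle_hits)
next
  fix \<gamma> assume \<gamma>: "crossing_limit_cycle cycle_field \<gamma> \<and> card (\<gamma> \<inter> S1) = 2"
  \<comment> \<open>An empty intersection has cardinality 0, so this orbit meets the circle and
    uniqueness applies.\<close>
  then have "\<gamma> \<inter> S1 \<noteq> {}" by auto
  then show "\<gamma> = cycle"
    using \<gamma> crossing_periodic_orbit_eq_cycle by (simp add: crossing_limit_cycle_def)
qed

end
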